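(* Let $n\ge2$, $N\ge1$, $\lambda\ge2$ be integers with $N\le\lambda^n$, let $\xi_1,\dots,\xi_N\in\mathbb{Z}^n\setminus\{0\}$, let $m_1,\dots,m_N$ be positive integers, and let $\{\nu_1,\dots,\nu_{\lambda^n}\}\subset\mathbb{Z}^n$ be a complete set of representatives of the distinct cosets of $\mathbb{Z}^n/\lambda\mathbb{Z}^n$ containing $0$. Let $\{\tau,q_{D,1},\dots,q_{D,N},q_{C,1},\dots,q_{C,\lambda^n}\}$ be a tight wavelet filter bank with prescribed directions (TWFPD) built from these data, as defined in the context. Let $a$ be the accuracy number and $b$ the flatness number of $\tau$. Then: (1) for each $l=1,\dots,N$, the directional wavelet mask $q_{D,l}$ has exactly $m_l$ vanishing moments; (2) $\min\{a,b\}\ge1$, and for each $\mu=1,\dots,\lambda^n$, the complementary wavelet mask $q_{C,\mu}$ has at least $\min\{a,b\}$ vanishing moments.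
   Context: Write $\mathbb{T}^n=\mathbb{R}^n/2\pi\mathbb{Z}^n$. A trigonometric polynomial on $\mathbb{T}^n$ is a finite linear combination of the functions $\omega\mapsto e^{-ik\cdot\omega}$, $k\in\mathbb{Z}^n$. Let $\Gamma$ be a complete set of representatives, containing $0$, of the distinct cosets of $2\pi\left((\lambda^{-1}\mathbb{Z}^n)/\mathbb{Z}^n\right)$, e.g. $\Gamma=\{2\pi k/\lambda:k\in\{0,\dots,\lambda-1\}^n\}$. The order of the root of a trigonometric polynomial $f$ at a point $\omega_0$ is the smallest $|\alpha|$, over multi-indices $\alpha$, with $\partial^\alpha f(\omega_0)\ne0$ (it is $0$ if $f(\omega_0)\neq0$, and $+\infty$ if $f\equiv 0$). The accuracy number of $\tau$ is the minimum, over $\gamma\in\Gamma\setminus\{0\}$, of the order of the root of $\tau$ at $\gamma$. The flatness number of $\tau$ is the order of the root of $\tau-\lambda^{n/2}$ at $0$. The number of vanishing moments of a mask $q$ is the order of the root of $q$ at $0$. TWFPD construction: for each $1\le l\le N$, let $B_l$ be a univariate trigonometric polynomial with real coefficients (a finite real linear combination of the functions $e^{-ikt}$, $k\in\mathbb{Z}$) such that $|B_l(t)|^2=1-\sin^{2m_l}(t/2)$ for all $t\in\mathbb{R}$ and $B_l(0)=1$, and put $p_l(\omega)=B_l(\xi_l\cdot\omega)$. The TWFPD consists of $$\tau(\omega)=\sum_{l=1}^{N}\lambda^{-n/2}p_l(\lambda\omega)e^{i\nu_l\cdot\omega}+\sum_{l=N+1}^{\lambda^n}\lambda^{-n/2}e^{i\nu_l\cdot\omega}$$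 (the second sum being empty if $N=\lambda^n$), the directional wavelet masks $$q_{D,l}(\omega)=\lambda^{-n/2}2^{-m_l}\left(1-e^{-i\lambda\xi_l\cdot\omega}\right)^{m_l}\tau(\omega),\qquad 1\le l\le N,$$ and the complementary wavelet masks $$q_{C,\mu}(\omega)=\begin{cases}e^{i\nu_\mu\cdot\omega}-\lambda^{-n/2}\tau(\omega)\overline{p_\mu(\lambda\omega)}, & 1\le\mu\le N,\\ e^{i\nu_\mu\cdot\omega}-\lambda^{-n/2}\tau(\omega), & N+1\le\mu\le\lambda^n.\end{cases}$$ *)

theory Defs
  imports "HOL-Analysis.Analysis" "HOL-Library.Extended_Nat"
begin

text \<open>
  Functions on the torus are represented by their lifts to \<^typ>\<open>real ^ 'n\<close>; the dimension
  is \<open>n = CARD('n)\<close>.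
\<close>

definition rvec :: "int ^ 'n \<Rightarrow> real ^ 'n" where
  "rvec k = (\<chi> i. of_int (k $ i))"

section \<open>Order of a root\<close>

definition partial_deriv :: "'n::finite \<Rightarrow> (real ^ 'n \<Rightarrow> complex) \<Rightarrow> real ^ 'n \<Rightarrow> complex" where
  "partial_deriv i f x = vector_derivative (\<lambda>t. f (x + t *\<^sub>R axis i 1)) (at 0)"

text \<open>
  An arbitrary enumeration of the coordinates fixes the order in which the partial derivatives
  are taken; this order is irrelevant for smooth functions, in particular for trigonometric
  polynomials.
\<close>

definition coords :: "'n::finite list" where
  "coords = (SOME is. distinct is \<and> set is = UNIV)"

definition multi_deriv :: "('n::finite \<Rightarrow> nat) \<Rightarrow> (real ^ 'n \<Rightarrow> complex) \<Rightarrow> real ^ 'n \<Rightarrow> complex" where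
  "multi_deriv \<alpha> f = foldr (\<lambda>i g. (partial_deriv i ^^ \<alpha> i) g) coords f"

text \<open>The infimum of the empty set is \<open>\<infinity>\<close>, which is the convention for \<open>f = 0\<close>.\<close>

definition root_order :: "(real ^ 'n::finite \<Rightarrow> complex) \<Rightarrow> real ^ 'n \<Rightarrow> enat" where
  "root_order f x = Inf {enat (\<Sum>i\<in>UNIV. \<alpha> i) | \<alpha>. multi_deriv \<alpha> f x \<noteq> 0}"

section \<open>Coset representatives\<close>

text \<open>
  \<open>\<nu> 1, \<dots>, \<nu> (\<lambda>\<^sup>n)\<close> represent each coset of \<open>\<lambda>\<int>\<^sup>n\<close> in \<open>\<int>\<^sup>n\<close>
  exactly once, and one of them is \<open>0\<close>.
\<close>

definition lattice_reps :: "nat \<Rightarrow> (nat \<Rightarrow> int ^ 'n::finite) \<Rightarrow> bool" where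
  "lattice_reps lam \<nu> \<longleftrightarrow>
     (\<exists>j\<in>{1..lam ^ CARD('n)}. \<nu> j = 0) \<and>
     (\<forall>k. \<exists>!j. j \<in> {1..lam ^ CARD('n)} \<and> (\<exists>z. k - \<nu> j = int lam *s z))"

text \<open>\<open>\<Gamma>\<close> represents each class of \<open>2\<pi>\<lambda>\<^sup>-\<^sup>1\<int>\<^sup>n\<close> modulo \<open>2\<pi>\<int>\<^sup>n\<close> exactly once.\<close>

definition dual_reps :: "nat \<Rightarrow> (real ^ 'n::finite) set \<Rightarrow> bool" where
  "dual_reps lam \<Gamma> \<longleftrightarrow>
     0 \<in> \<Gamma> \<and>
     \<Gamma> \<subseteq> range (\<lambda>k. (2 * pi / real lam) *\<^sub>R rvec k) \<and>
     (\<forall>k. \<exists>!\<gamma>. \<gamma> \<in> \<Gamma> \<and> (\<exists>z. (2 * pi / real lam) *\<^sub>R rvec k - \<gamma> = (2 * pi) *\<^sub>R rvec z))"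

section \<open>Accuracy, flatness and vanishing moments\<close>

definition accuracy_number :: "(real ^ 'n::finite) set \<Rightarrow> (real ^ 'n \<Rightarrow> complex) \<Rightarrow> enat" where
  "accuracy_number \<Gamma> \<tau> = (INF \<gamma>\<in>\<Gamma> - {0}. root_order \<tau> \<gamma>)"

definition flatness_number :: "nat \<Rightarrow> (real ^ 'n::finite \<Rightarrow> complex) \<Rightarrow> enat" where
  "flatness_number lam \<tau> =
     root_order (\<lambda>\<omega>. \<tau> \<omega> - of_real (real lam powr (real CARD('n) / 2))) 0"

definition vanishing_moments :: "(real ^ 'n::finite \<Rightarrow> complex) \<Rightarrow> enat" where
  "vanishing_moments q = root_order q 0"

section \<open>Tight wavelet filter banks with prescribed directions\<close>

definition real_trig_poly :: "(real \<Rightarrow> complex) \<Rightarrow> bool" where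
  "real_trig_poly B \<longleftrightarrow>
     (\<exists>(K :: int set) (c :: int \<Rightarrow> real). finite K \<and>
        (\<forall>t. B t = (\<Sum>k\<in>K. of_real (c k) * cis (- (of_int k * t)))))"

text \<open>
  Only \<open>qD l\<close> for \<open>1 \<le> l \<le> N\<close> and \<open>qC \<mu>\<close> for \<open>1 \<le> \<mu> \<le> \<lambda>\<^sup>n\<close> belong to the filter bank;
  other values are unconstrained.
\<close>

definition is_TWFPD ::
  "nat \<Rightarrow> nat \<Rightarrow> (nat \<Rightarrow> int ^ 'n::finite) \<Rightarrow> (nat \<Rightarrow> nat) \<Rightarrow> (nat \<Rightarrow> int ^ 'n) \<Rightarrow>
   (real ^ 'n \<Rightarrow> complex) \<Rightarrow> (nat \<Rightarrow> real ^ 'n \<Rightarrow> complex) \<Rightarrow> (nat \<Rightarrow> real ^ 'n \<Rightarrow> complex) \<Rightarrow> bool"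
where
  "is_TWFPD lam N \<xi> m \<nu> \<tau> qD qC \<longleftrightarrow>
     (\<exists>(B :: nat \<Rightarrow> real \<Rightarrow> complex) (p :: nat \<Rightarrow> real ^ 'n \<Rightarrow> complex) (s :: complex).
        s = of_real (real lam powr (- (real CARD('n) / 2))) \<and>
        (\<forall>l\<in>{1..N}. real_trig_poly (B l) \<and>
           (\<forall>t. (cmod (B l t))\<^sup>2 = 1 - sin (t / 2) ^ (2 * m l)) \<and> B l 0 = 1) \<and>
        (\<forall>l\<in>{1..N}. \<forall>\<omega>. p l \<omega> = B l (rvec (\<xi> l) \<bullet> \<omega>)) \<and>
        (\<forall>\<omega>. \<tau> \<omega> =
           (\<Sum>l = 1..N. s * p l (real lam *\<^sub>R \<omega>) * cis (rvec (\<nu> l) \<bullet> \<omega>)) +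
           (\<Sum>l = N + 1..lam ^ CARD('n). s * cis (rvec (\<nu> l) \<bullet> \<omega>))) \<and>
        (\<forall>l\<in>{1..N}. \<forall>\<omega>. qD l \<omega> =
           s * (1 / 2 ^ m l) * (1 - cis (- (real lam * (rvec (\<xi> l) \<bullet> \<omega>)))) ^ m l * \<tau> \<omega>) \<and>
        (\<forall>\<mu>\<in>{1..N}. \<forall>\<omega>. qC \<mu> \<omega> =
           cis (rvec (\<nu> \<mu>) \<bullet> \<omega>) - s * \<tau> \<omega> * cnj (p \<mu> (real lam *\<^sub>R \<omega>))) \<and>
        (\<forall>\<mu>\<in>{N + 1..lam ^ CARD('n)}. \<forall>\<omega>. qC \<mu> \<omega> =
           cis (rvec (\<nu> \<mu>) \<bullet> \<omega>) - s * \<tau> \<omega>))"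

end

theory Submission
  imports Defs
begin

text \<open>
  Write \<open>P\<^sub>\<mu>(\<omega>)\<close> for \<open>p\<^sub>\<mu>(\<lambda>\<omega>)\<close>, with \<open>P\<^sub>\<mu> = 1\<close> for \<open>\<mu> > N\<close>, and \<open>s = \<lambda>\<^sup>-\<^sup>n\<^sup>/\<^sup>2\<close>. Every \<open>P\<^sub>\<mu>\<close> is invariant
  under translation by \<open>\<gamma> \<in> \<Gamma>\<close>, so orthogonality of characters turns
  \<open>\<tau>(\<omega>) = \<Sum>\<^sub>l s P\<^sub>l(\<omega>) exp(i \<nu>\<^sub>l\<cdot>\<omega>)\<close> into the polyphase identity
  \<open>\<Sum>\<^sub>\<gamma> \<tau>(\<omega>+\<gamma>) exp(-i \<nu>\<^sub>\<mu>\<cdot>(\<omega>+\<gamma>)) = s |\<Gamma>| P\<^sub>\<mu>(\<omega>)\<close>. Modulo functions vanishing at \<open>0\<close> to order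
  \<open>min a b\<close>, its left side is \<open>s\<^sup>-\<^sup>1 exp(-i \<nu>\<^sub>\<mu>\<cdot>\<omega>)\<close>, whence \<open>P\<^sub>\<mu> \<equiv> exp(-i \<nu>\<^sub>\<mu>\<cdot>\<omega>)\<close>, and
  \<open>q\<^sub>C\<^sub>,\<^sub>\<mu> = exp(i \<nu>\<^sub>\<mu>\<cdot>\<omega>) - s \<tau> cnj P\<^sub>\<mu> \<equiv> 0\<close>. The order of \<open>q\<^sub>D\<^sub>,\<^sub>l\<close> is read off its factorisation, since
  \<open>\<tau>(0) \<noteq> 0\<close> and \<open>1 - exp(-i\<lambda>\<xi>\<^sub>l\<cdot>\<omega>)\<close> has a simple zero at \<open>0\<close>.
\<close>

section \<open>Exponential polynomials\<close>

text \<open>Trigonometric polynomials with arbitrary real frequencies. Generating the class from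
  single characters by addition lets closure properties and derivative rules be checked on one
  character at a time.\<close>

inductive exp_poly :: "(real ^ 'n::finite \<Rightarrow> complex) \<Rightarrow> bool" where
  exp_poly_term: "exp_poly (\<lambda>\<omega>. c * cis (v \<bullet> \<omega>))"
| exp_poly_add: "exp_poly f \<Longrightarrow> exp_poly g \<Longrightarrow> exp_poly (\<lambda>\<omega>. f \<omega> + g \<omega>)"

lemma exp_poly_const: "exp_poly (\<lambda>\<omega>. c)"
  using exp_poly_term[of c 0] by simp

lemma exp_poly_cis: "exp_poly (\<lambda>\<omega>. cis (v \<bullet> \<omega>))"
  using exp_poly_term[of 1 v] by simp

lemma exp_poly_mult:
  assumes "exp_poly f" "exp_poly g"
  shows "exp_poly (\<lambda>\<omega>. f \<omega> * g \<omega>)"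
  using assms(1)
proof induction
  case (exp_poly_term c v)
  show ?case using assms(2)
  proof induction
    case (exp_poly_term d w)
    show ?case
      using exp_poly.exp_poly_term[of "c * d" "v + w"]
      by (simp add: inner_add_left flip: cis_mult) (simp add: mult_ac)
  qed (simp add: distrib_left exp_poly_add)
qed (simp add: distrib_right exp_poly_add)

lemma exp_poly_diff:
  assumes "exp_poly f" "exp_poly g"
  shows "exp_poly (\<lambda>\<omega>. f \<omega> - g \<omega>)"
  using exp_poly_add[OF assms(1) exp_poly_mult[OF exp_poly_const[of "-1"] assms(2)]] by simp

lemma exp_poly_cnj: "exp_poly f \<Longrightarrow> exp_poly (\<lambda>\<omega>. cnj (f \<omega>))"
proof (induction rule: exp_poly.induct)
  case (exp_poly_term c v)
  show ?case using exp_poly.exp_poly_term[of "cnj c" "- v"] by (simp add: cis_cnj)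
qed (simp add: exp_poly_add)

lemma exp_poly_shift: "exp_poly f \<Longrightarrow> exp_poly (\<lambda>\<omega>. f (\<omega> + y))"
proof (induction rule: exp_poly.induct)
  case (exp_poly_term c v)
  show ?case
    using exp_poly.exp_poly_term[of "c * cis (v \<bullet> y)" v]
    by (simp add: inner_add_right flip: cis_mult) (simp add: mult_ac)
qed (simp add: exp_poly_add)

lemma exp_poly_power: "exp_poly f \<Longrightarrow> exp_poly (\<lambda>\<omega>. f \<omega> ^ k)"
  by (induction k) (auto intro: exp_poly_const exp_poly_mult)

lemma exp_poly_sum: "(\<And>i. i \<in> A \<Longrightarrow> exp_poly (f i)) \<Longrightarrow> exp_poly (\<lambda>\<omega>. \<Sum>i\<in>A. f i \<omega>)"
  by (induction A rule: infinite_finite_induct) (auto intro: exp_poly_const exp_poly_add)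

lemmas exp_poly_intros =
  exp_poly_const exp_poly_cis exp_poly_add exp_poly_mult exp_poly_diff exp_poly_cnj
  exp_poly_shift exp_poly_power exp_poly_sum

section \<open>Partial derivatives of exponential polynomials\<close>

lemma partial_deriv_eqI:
  "((\<lambda>t. f (x + t *\<^sub>R axis i 1)) has_vector_derivative D) (at 0) \<Longrightarrow> partial_deriv i f x = D"
  unfolding partial_deriv_def by (rule vector_derivative_at)

lemma term_has_partial:
  "((\<lambda>t. c * cis (v \<bullet> (x + t *\<^sub>R axis i 1))) has_vector_derivative
     (\<i> * of_real (v $ i) * c) * cis (v \<bullet> x)) (at 0)"
proof -
  have "((\<lambda>t. c * exp (\<i> * of_real (v \<bullet> x + t * v $ i))) has_vector_derivative
      (\<i> * of_real (v $ i) * c) * exp (\<i> * of_real (v \<bullet> x))) (at 0)"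
    by (auto intro!: derivative_eq_intros has_vector_derivative_real_field simp: mult_ac)
  then show ?thesis
    by (simp add: cis_conv_exp inner_add_right inner_axis)
qed

lemma partial_deriv_term:
  "partial_deriv i (\<lambda>\<omega>. c * cis (v \<bullet> \<omega>)) = (\<lambda>\<omega>. (\<i> * of_real (v $ i) * c) * cis (v \<bullet> \<omega>))"
  by (rule ext, rule partial_deriv_eqI, rule term_has_partial)

text \<open>\<open>partial_deriv\<close> rests on the total operator
  \<open>vector_derivative\<close>, so differentiability must be supplied before the sum, product
  and conjugation rules can be used.\<close>

lemma exp_poly_has_partial:
  assumes "exp_poly f"
  shows "((\<lambda>t. f (x + t *\<^sub>R axis i 1)) has_vector_derivative partial_deriv i f x) (at 0)"
proof -
  have "(\<lambda>t. f (x + t *\<^sub>R axis i 1)) differentiable (at 0)"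
    using assms
  proof induction
    case (exp_poly_term c v)
    show ?case using term_has_partial[of c v x i] by (rule differentiableI_vector)
  qed (rule differentiable_add)
  then show ?thesis
    unfolding partial_deriv_def by (simp add: vector_derivative_works)
qed

lemma partial_deriv_add:
  assumes "exp_poly f" "exp_poly g"
  shows "partial_deriv i (\<lambda>\<omega>. f \<omega> + g \<omega>) = (\<lambda>\<omega>. partial_deriv i f \<omega> + partial_deriv i g \<omega>)"
  by (rule ext, rule partial_deriv_eqI)
    (intro has_vector_derivative_add exp_poly_has_partial assms)

lemma partial_deriv_mult:
  assumes "exp_poly f" "exp_poly g"
  shows "partial_deriv i (\<lambda>\<omega>. f \<omega> * g \<omega>) =
    (\<lambda>\<omega>. f \<omega> * partial_deriv i g \<omega> + partial_deriv i f \<omega> * g \<omega>)"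
  using has_vector_derivative_mult[OF assms[THEN exp_poly_has_partial]]
  by (intro ext partial_deriv_eqI) auto

lemma partial_deriv_cnj:
  assumes "exp_poly f"
  shows "partial_deriv i (\<lambda>\<omega>. cnj (f \<omega>)) = (\<lambda>\<omega>. cnj (partial_deriv i f \<omega>))"
  by (rule ext, rule partial_deriv_eqI)
    (intro has_vector_derivative_cnj exp_poly_has_partial assms)

lemma partial_deriv_shift:
  "partial_deriv i (\<lambda>\<omega>. f (\<omega> + y)) = (\<lambda>\<omega>. partial_deriv i f (\<omega> + y))"
  by (simp add: partial_deriv_def fun_eq_iff add_ac)

lemma partial_deriv_const: "partial_deriv i (\<lambda>\<omega>. c) = (\<lambda>\<omega>. 0)"
  using partial_deriv_term[of i c 0] by simp

lemma exp_poly_partial_deriv: "exp_poly f \<Longrightarrow> exp_poly (partial_deriv i f)"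
  by (induction rule: exp_poly.induct)
    (auto simp only: partial_deriv_term partial_deriv_add intro: exp_poly.intros)

text \<open>On a character each partial derivative is multiplication by a scalar, so symmetry is
  immediate there and extends by additivity.\<close>

lemma partial_deriv_commute:
  "exp_poly f \<Longrightarrow> partial_deriv i (partial_deriv j f) = partial_deriv j (partial_deriv i f)"
proof (induction rule: exp_poly.induct)
  case (exp_poly_term c v)
  show ?case by (simp only: partial_deriv_term) (simp only: mult_ac)
qed (simp add: partial_deriv_add exp_poly_partial_deriv)

section \<open>Vanishing to a given order\<close>

text \<open>All partial derivatives of order less than \<open>d\<close> vanish at \<open>x\<close>.
  The recursion through first partials replaces multi-indices, so that arguments with the product
  rule become inductions on \<open>d\<close>.\<close>

primrec vanishes :: "nat \<Rightarrow> (real ^ 'n::finite \<Rightarrow> complex) \<Rightarrow> real ^ 'n \<Rightarrow> bool" where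
  "vanishes 0 f x \<longleftrightarrow> True"
| "vanishes (Suc d) f x \<longleftrightarrow> f x = 0 \<and> (\<forall>i. vanishes d (partial_deriv i f) x)"

lemma vanishes_Suc_imp: "vanishes (Suc d) f x \<Longrightarrow> vanishes d f x"
  by (induction d arbitrary: f) auto

lemma vanishes_zero: "vanishes d (\<lambda>\<omega>. 0) x"
  by (induction d) (simp_all add: partial_deriv_const)

lemma vanishes_add:
  assumes "exp_poly f" "exp_poly g" "vanishes d f x" "vanishes d g x"
  shows "vanishes d (\<lambda>\<omega>. f \<omega> + g \<omega>) x"
  using assms
  by (induction d arbitrary: f g) (simp_all add: partial_deriv_add exp_poly_partial_deriv)

text \<open>The ideal property. In \<open>g * partial_deriv i f + partial_deriv i g * f\<close> both
  \<open>partial_deriv i f\<close> and \<open>f\<close> vanish to order \<open>d\<close>, so the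
  induction, general in both factors, covers each summand.\<close>

lemma vanishes_mult_left:
  assumes "exp_poly f" "exp_poly g" "vanishes d f x"
  shows "vanishes d (\<lambda>\<omega>. g \<omega> * f \<omega>) x"
  using assms
proof (induction d arbitrary: f g)
  case (Suc d)
  then have "vanishes d f x" by (simp only: vanishes_Suc_imp)
  with Suc show ?case
    by (auto simp: partial_deriv_mult intro!: vanishes_add exp_poly_mult exp_poly_partial_deriv)
qed simp

lemma vanishes_sum:
  assumes "\<And>i. i \<in> A \<Longrightarrow> exp_poly (f i)" "\<And>i. i \<in> A \<Longrightarrow> vanishes d (f i) x"
  shows "vanishes d (\<lambda>\<omega>. \<Sum>i\<in>A. f i \<omega>) x"
  using assms
  by (induction A rule: infinite_finite_induct)
    (auto intro!: vanishes_zero vanishes_add exp_poly_sum)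

lemma vanishes_cnj:
  assumes "exp_poly f" "vanishes d f x"
  shows "vanishes d (\<lambda>\<omega>. cnj (f \<omega>)) x"
  using assms
  by (induction d arbitrary: f) (simp_all add: partial_deriv_cnj exp_poly_partial_deriv)

lemma vanishes_shift: "vanishes d f (x + y) \<Longrightarrow> vanishes d (\<lambda>\<omega>. f (\<omega> + y)) x"
  by (induction d arbitrary: f) (simp_all add: partial_deriv_shift)

text \<open>A zero of \<open>u\<close> raises the order by one. In the product rule the summand with
  \<open>partial_deriv i f\<close> is the induction hypothesis, and the one with
  \<open>partial_deriv i u\<close> is the ideal property.\<close>

lemma vanishes_mult_zero:
  assumes "exp_poly f" "exp_poly u" "u x = 0" "vanishes d f x"
  shows "vanishes (Suc d) (\<lambda>\<omega>. u \<omega> * f \<omega>) x"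
  using assms
proof (induction d arbitrary: f)
  case 0
  then show ?case by simp
next
  case (Suc d)
  have "vanishes (Suc d) (\<lambda>\<omega>. u \<omega> * partial_deriv i f \<omega> + partial_deriv i u \<omega> * f \<omega>) x" for i
  proof (rule vanishes_add)
    show "vanishes (Suc d) (\<lambda>\<omega>. u \<omega> * partial_deriv i f \<omega>) x"
      using Suc by (intro Suc.IH) (auto intro: exp_poly_partial_deriv)
  qed (use Suc in \<open>auto intro: exp_poly_mult exp_poly_partial_deriv vanishes_mult_left
      simp del: vanishes.simps\<close>)
  then show ?case
    using Suc.prems by (simp add: partial_deriv_mult)
qed

lemma vanishes_power:
  assumes "exp_poly u" "u x = 0"
  shows "vanishes k (\<lambda>\<omega>. u \<omega> ^ k) x"
proof (induction k)
  case (Suc k)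
  show ?case
    using vanishes_mult_zero[OF exp_poly_power[OF assms(1)] assms Suc] by simp
qed simp

text \<open>Sharpness of the order at a simple zero of \<open>u\<close>. Differentiating in
  direction \<open>i\<close> strips off one factor \<open>u\<close> and replaces \<open>g\<close> by
  another cofactor that is nonzero at \<open>x\<close>; hence the induction is general in
  \<open>g\<close>.\<close>

lemma not_vanishes_power_mult:
  assumes "exp_poly u" "u x = 0" "partial_deriv i u x \<noteq> 0"
  shows "exp_poly g \<Longrightarrow> g x \<noteq> 0 \<Longrightarrow> \<not> vanishes (Suc k) (\<lambda>\<omega>. u \<omega> ^ k * g \<omega>) x"
proof (induction k arbitrary: g)
  case 0
  then show ?case by simp
next
  case (Suc k)
  \<comment> \<open>The cofactor left after extracting \<open>u ^ k\<close> from the derivative of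
    \<open>u ^ Suc k * g\<close>. At \<open>x\<close> its second summand vanishes and the first does
    not.\<close>
  define h where
    "h = (\<lambda>\<omega>. of_nat (Suc k) * partial_deriv i u \<omega> * g \<omega> + u \<omega> * partial_deriv i g \<omega>)"
  have pow: "partial_deriv i (\<lambda>\<omega>. u \<omega> ^ Suc j) =
      (\<lambda>\<omega>. of_nat (Suc j) * u \<omega> ^ j * partial_deriv i u \<omega>)" for j
  proof (induction j)
    case (Suc j)
    have "partial_deriv i (\<lambda>\<omega>. u \<omega> * u \<omega> ^ Suc j) =
        (\<lambda>\<omega>. of_nat (Suc (Suc j)) * u \<omega> ^ Suc j * partial_deriv i u \<omega>)"
      unfolding partial_deriv_mult[OF assms(1) exp_poly_power[OF assms(1)]] Suc
      by (simp add: algebra_simps)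
    then show ?case by simp
  qed simp
  have "partial_deriv i (\<lambda>\<omega>. u \<omega> ^ Suc k * g \<omega>) = (\<lambda>\<omega>. u \<omega> ^ k * h \<omega>)"
    unfolding partial_deriv_mult[OF exp_poly_power[OF assms(1)] Suc.prems(1)] pow h_def
    by (simp add: algebra_simps)
  moreover have "exp_poly h"
    unfolding h_def by (intro exp_poly_intros exp_poly_partial_deriv assms Suc.prems)
  moreover have "h x \<noteq> 0"
    using assms Suc.prems by (simp add: h_def del: of_nat_Suc)
  ultimately have "\<not> vanishes (Suc k) (partial_deriv i (\<lambda>\<omega>. u \<omega> ^ Suc k * g \<omega>)) x"
    using Suc.IH by simp
  then show ?case by (auto simp del: power_Suc)
qed

section \<open>Iterated partial derivatives and the order of a root\<close>

abbreviation partials ::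
  "('n::finite \<Rightarrow> nat) \<Rightarrow> 'n list \<Rightarrow> (real ^ 'n \<Rightarrow> complex) \<Rightarrow> real ^ 'n \<Rightarrow> complex" where
  "partials \<alpha> is f \<equiv> foldr (\<lambda>i g. (partial_deriv i ^^ \<alpha> i) g) is f"

lemma exp_poly_funpow_partial_deriv: "exp_poly f \<Longrightarrow> exp_poly ((partial_deriv i ^^ k) f)"
  by (induction k) (auto intro: exp_poly_partial_deriv)

lemma exp_poly_partials: "exp_poly f \<Longrightarrow> exp_poly (partials \<alpha> is f)"
  by (induction "is") (auto intro: exp_poly_funpow_partial_deriv)

lemma funpow_partial_deriv_commute:
  assumes "exp_poly f"
  shows "(partial_deriv j ^^ k) (partial_deriv i f) = partial_deriv i ((partial_deriv j ^^ k) f)"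
  using assms
  by (induction k) (simp_all add: partial_deriv_commute exp_poly_funpow_partial_deriv)

lemma partials_commute:
  assumes "exp_poly f"
  shows "partials \<alpha> is (partial_deriv i f) = partial_deriv i (partials \<alpha> is f)"
  using assms
  by (induction "is") (simp_all add: funpow_partial_deriv_commute exp_poly_partials)

lemma partials_cong: "(\<And>i. i \<in> set is \<Longrightarrow> \<alpha> i = \<beta> i) \<Longrightarrow> partials \<alpha> is f = partials \<beta> is f"
  by (induction "is") auto

text \<open>One more derivative in direction \<open>i\<close> raises the entry of the multi-index at
  \<open>i\<close>. Distinctness ensures that the raised entry acts at a single place; the rest of
  the list does not see the change.\<close>

lemma partials_partial_deriv:
  assumes "exp_poly f" "distinct is" "i \<in> set is"
  shows "partials \<alpha> is (partial_deriv i f) = partials (\<alpha>(i := Suc (\<alpha> i))) is f"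
  using assms
proof (induction "is")
  case (Cons j js)
  show ?case
  proof (cases "j = i")
    case True
    with Cons.prems have "partials \<alpha> js f = partials (\<alpha>(i := Suc (\<alpha> i))) js f"
      by (intro partials_cong) auto
    with True Cons.prems show ?thesis
      by (simp add: partials_commute funpow_partial_deriv_commute exp_poly_partials)
  next
    case False
    with Cons show ?thesis by simp
  qed
qed simp

lemma vanishes_funpow_partial_deriv:
  "vanishes (d + k) f x \<Longrightarrow> vanishes d ((partial_deriv i ^^ k) f) x"
  by (induction k arbitrary: f) (auto simp del: funpow.simps simp: funpow_Suc_right)

lemma vanishes_partials:
  "vanishes (d + (\<Sum>i\<leftarrow>is. \<alpha> i)) f x \<Longrightarrow> vanishes d (partials \<alpha> is f) x"
proof (induction "is" arbitrary: d)
  case (Cons j js)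
  then have "vanishes (d + \<alpha> j) (partials \<alpha> js f) x"
    by (intro Cons.IH) (simp add: add.assoc)
  then show ?case by (simp add: vanishes_funpow_partial_deriv)
qed simp

lemma distinct_coords: "distinct (coords :: 'n::finite list)"
  and set_coords: "set (coords :: 'n::finite list) = UNIV"
proof -
  have "\<exists>is :: 'n list. distinct is \<and> set is = UNIV"
    using finite_distinct_list[OF finite] by blast
  from someI_ex[OF this] show "distinct (coords :: 'n list)" "set (coords :: 'n list) = UNIV"
    unfolding coords_def by auto
qed

lemma vanishes_antimono: "vanishes e f x \<Longrightarrow> d \<le> e \<Longrightarrow> vanishes d f x"
  by (induction e) (auto simp only: vanishes_Suc_imp le_Suc_eq)

text \<open>Links the recursive notion to the multi-index derivatives in \<open>root_order\<close>.
  For the converse, the zero multi-index gives the value of \<open>f\<close>, and derivatives of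
  \<open>partial_deriv i f\<close> are derivatives of \<open>f\<close> with a raised index.\<close>

lemma vanishes_iff_multi_deriv:
  assumes "exp_poly f"
  shows "vanishes d f x \<longleftrightarrow> (\<forall>\<alpha>. (\<Sum>i\<in>UNIV. \<alpha> i) < d \<longrightarrow> multi_deriv \<alpha> f x = 0)"
proof
  assume *: "vanishes d f x"
  show "\<forall>\<alpha>. (\<Sum>i\<in>UNIV. \<alpha> i) < d \<longrightarrow> multi_deriv \<alpha> f x = 0"
  proof (intro allI impI)
    fix \<alpha> :: "'a \<Rightarrow> nat"
    assume "(\<Sum>i\<in>UNIV. \<alpha> i) < d"
    moreover have "(\<Sum>i\<leftarrow>coords. \<alpha> i) = (\<Sum>i\<in>UNIV. \<alpha> i)"
      by (simp add: sum_list_distinct_conv_sum_set distinct_coords set_coords)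
    \<comment> \<open>Order \<open>1\<close> is what remains after spending the total degree of
      \<open>\<alpha>\<close>, which is less than \<open>d\<close>; it says that the value is
      \<open>0\<close>.\<close>
    ultimately have "vanishes 1 (partials \<alpha> coords f) x"
      by (intro vanishes_partials vanishes_antimono[OF *]) simp
    then show "multi_deriv \<alpha> f x = 0"
      by (simp add: multi_deriv_def)
  qed
next
  assume "\<forall>\<alpha>. (\<Sum>i\<in>UNIV. \<alpha> i) < d \<longrightarrow> multi_deriv \<alpha> f x = 0"
  then show "vanishes d f x" using assms
  proof (induction d arbitrary: f)
    case (Suc d)
    have "multi_deriv (\<lambda>_. 0) f = f"
    proof -
      have "partials (\<lambda>_. 0) is f = f" for "is" by (induction "is") auto
      then show ?thesis by (simp add: multi_deriv_def)
    qed
    then have "f x = 0" using Suc.prems(1) by (metis sum.neutral_const zero_less_Suc)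
    moreover have "vanishes d (partial_deriv i f) x" for i
    proof (rule Suc.IH, intro allI impI)
      fix \<alpha> :: "'a \<Rightarrow> nat"
      assume "(\<Sum>j\<in>UNIV. \<alpha> j) < d"
      moreover have "(\<Sum>j\<in>UNIV. (\<alpha>(i := Suc (\<alpha> i))) j) = Suc (\<Sum>j\<in>UNIV. \<alpha> j)"
        by (simp add: sum.remove[of UNIV i])
      ultimately have "multi_deriv (\<alpha>(i := Suc (\<alpha> i))) f x = 0"
        using Suc.prems(1) by simp
      then show "multi_deriv \<alpha> (partial_deriv i f) x = 0"
        by (simp add: multi_deriv_def partials_partial_deriv Suc.prems distinct_coords set_coords)
    qed (simp add: exp_poly_partial_deriv Suc.prems)
    ultimately show ?case by simp
  qed simp
qed

lemma enat_le_root_order_iff: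
  assumes "exp_poly f"
  shows "enat d \<le> root_order f x \<longleftrightarrow> vanishes d f x"
  unfolding vanishes_iff_multi_deriv[OF assms] root_order_def le_Inf_iff
  by (auto simp: not_less[symmetric])

lemma root_order_eqI:
  assumes "exp_poly f" "vanishes d f x" "\<not> vanishes (Suc d) f x"
  shows "root_order f x = enat d"
  using assms enat_le_root_order_iff[OF assms(1), of d x]
    enat_le_root_order_iff[OF assms(1), of "Suc d" x]
  by (metis Suc_ile_eq order_le_less)

text \<open>\<open>vanishes\<close> only speaks of finite orders, while accuracy, flatness and root
  orders may be infinite; finite lower bounds suffice for comparing them.\<close>

lemma enat_le_by_finite:
  assumes "\<And>d. enat d \<le> x \<Longrightarrow> enat d \<le> y"
  shows "x \<le> y"
proof (cases x)
  case (enat d)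
  then show ?thesis using assms[of d] by simp
next
  case infinity
  show ?thesis
  proof (cases y)
    case (enat k)
    then show ?thesis using assms[of "Suc k"] infinity by simp
  qed simp
qed

section \<open>Character sums\<close>

text \<open>Translation by \<open>e\<close> permutes the classes modulo \<open>H\<close> represented
  by \<open>A\<close>, and \<open>ch\<close> is constant on classes, so the sum equals
  \<open>ch e\<close> times itself. The form covers both the representatives of the integer lattice
  and \<open>\<Gamma>\<close>.\<close>

lemma character_sum_eq_0:
  fixes ch :: "'g::ab_group_add \<Rightarrow> complex"
  assumes "finite A" "A \<subseteq> C"
    and C: "\<And>x. x \<in> C \<Longrightarrow> x + e \<in> C"
    and reps: "\<And>x. x \<in> C \<Longrightarrow> \<exists>!a. a \<in> A \<and> x - a \<in> H"
    and H: "0 \<in> H" "\<And>x y. x \<in> H \<Longrightarrow> y \<in> H \<Longrightarrow> x - y \<in> H"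
    and ch: "\<And>x y. ch (x + y) = ch x * ch y" "\<And>h. h \<in> H \<Longrightarrow> ch h = 1"
    and e: "ch e \<noteq> 1"
  shows "sum ch A = 0"
proof -
  \<comment> \<open>The representative in \<open>A\<close> of the class of \<open>a + e\<close>;
    injective on the finite set \<open>A\<close>, hence a permutation of it.\<close>
  define g where "g a = (THE a'. a' \<in> A \<and> a + e - a' \<in> H)" for a
  have g: "g a \<in> A" "a + e - g a \<in> H" if "a \<in> A" for a
    using theI'[OF reps[OF C]] that \<open>A \<subseteq> C\<close> unfolding g_def by blast+
  have "inj_on g A"
  proof (rule inj_onI)
    fix a b assume ab: "a \<in> A" "b \<in> A" "g a = g b"
    then have "(a + e - g a) - (b + e - g b) \<in> H" by (intro H g)
    then have "a - b \<in> H" using ab by simp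
    moreover have "a - a \<in> H" using H by simp
    ultimately show "a = b" using reps[of a] ab \<open>A \<subseteq> C\<close> by blast
  qed
  moreover have "g ` A = A"
    using endo_inj_surj[OF \<open>finite A\<close> _ \<open>inj_on g A\<close>] g by auto
  ultimately have "sum ch A = (\<Sum>a\<in>A. ch (g a))"
    using sum.reindex[of g A ch] by simp
  also have "\<dots> = (\<Sum>a\<in>A. ch e * ch a)"
  proof (rule sum.cong)
    fix a assume "a \<in> A"
    then have "ch ((a + e - g a) + g a) = ch (g a)"
      by (simp only: ch g mult_1)
    then show "ch (g a) = ch e * ch a"
      using ch(1)[of a e] by (simp add: mult.commute)
  qed simp
  also have "\<dots> = ch e * sum ch A"
    by (simp only: sum_distrib_left)
  finally have "sum ch A = ch e * sum ch A" .
  with e show ?thesis by simp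
qed

lemma rvec_add: "rvec (x + y) = rvec x + rvec y"
  and rvec_diff: "rvec (x - y) = rvec x - rvec y"
  and rvec_0: "rvec 0 = 0"
  and rvec_mult: "rvec (c *s x) = of_int c *\<^sub>R rvec x"
  by (simp_all add: rvec_def vec_eq_iff)

lemma rvec_inner: "rvec x \<bullet> rvec y = of_int (\<Sum>i\<in>UNIV. x $ i * y $ i)"
  by (simp add: rvec_def inner_vec_def)

lemma rvec_axis: "rvec (axis i 1) = axis i 1"
  by (simp add: rvec_def vec_eq_iff axis_def)

lemma cis_2pi_int: "cis (2 * pi * of_int k) = 1"
  by (rule cis_multiple_2pi) simp

lemma cis_rvec_inner: "cis (rvec k \<bullet> ((2 * pi) *\<^sub>R rvec z)) = 1"
  by (simp add: rvec_inner cis_2pi_int del: of_int_sum)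

text \<open>Supplies the translation \<open>e\<close> for both character sums: were every axis to
  give \<open>1\<close>, \<open>lam\<close> would divide each coordinate of
  \<open>k\<close>.\<close>

lemma exists_axis_character:
  assumes "lam > 0" "\<nexists>z. k = int lam *s z"
  shows "\<exists>i. cis (rvec k \<bullet> ((2 * pi / real lam) *\<^sub>R axis i 1)) \<noteq> 1"
proof (rule ccontr)
  assume *: "\<not> ?thesis"
  have "int lam dvd k $ i" for i
  proof -
    have "cis (2 * pi / real lam * of_int (k $ i)) = 1"
      using * by (simp add: inner_axis rvec_def)
    then have "cos (2 * pi / real lam * of_int (k $ i)) = 1"
      by (metis cis.sel(1) one_complex.sel(1))
    then obtain j :: int where "2 * pi / real lam * of_int (k $ i) = of_int j * 2 * pi"
      unfolding cos_one_2pi_int by blast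
    then have "real_of_int (k $ i) = real_of_int (int lam * j)"
      using assms(1) by (simp add: field_simps)
    then show ?thesis by (metis dvd_triv_left of_int_eq_iff)
  qed
  then have "k = int lam *s (\<chi> i. k $ i div int lam)"
    by (simp add: vec_eq_iff)
  with assms(2) show False by blast
qed

lemma lattice_character_sum:
  fixes \<nu> :: "nat \<Rightarrow> int ^ 'n::finite"
  assumes "lam > 0" "lattice_reps lam \<nu>" "\<nexists>z. k = int lam *s z"
  shows "(\<Sum>l = 1..lam ^ CARD('n). cis (rvec (\<nu> l) \<bullet> ((2 * pi / real lam) *\<^sub>R rvec k))) = 0"
proof -
  let ?J = "{1..lam ^ CARD('n)}" and ?ch = "\<lambda>x. cis (rvec x \<bullet> ((2 * pi / real lam) *\<^sub>R rvec k))"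
  let ?H = "range (\<lambda>z :: int ^ 'n. int lam *s z)"
  have reps: "\<exists>!j. j \<in> ?J \<and> x - \<nu> j \<in> ?H" for x
    using assms(2) by (auto simp: lattice_reps_def image_iff)
  have H: "0 \<in> ?H" "\<And>x y. x \<in> ?H \<Longrightarrow> y \<in> ?H \<Longrightarrow> x - y \<in> ?H"
    by (auto simp: image_iff simp flip: vector_sub_rdistrib vector_ssub_ldistrib intro: exI[of _ 0])
  \<comment> \<open>The general lemma sums over a set of representatives; injectivity carries the
    result back to the indexed family.\<close>
  have inj: "inj_on \<nu> ?J"
  proof (rule inj_onI)
    fix i j assume "i \<in> ?J" "j \<in> ?J" "\<nu> i = \<nu> j"
    moreover have "\<nu> i - \<nu> i \<in> ?H" using H(1) by simp
    ultimately show "i = j" using reps[of "\<nu> i"] by metis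
  qed
  obtain i where i: "cis (rvec k \<bullet> ((2 * pi / real lam) *\<^sub>R axis i 1)) \<noteq> 1"
    using exists_axis_character[OF assms(1,3)] by blast
  have "sum ?ch (\<nu> ` ?J) = 0"
  proof (rule character_sum_eq_0[where C = UNIV and e = "axis i 1" and H = ?H])
    show "\<exists>!a. a \<in> \<nu> ` ?J \<and> x - a \<in> ?H" for x
    proof -
      obtain j where j: "j \<in> ?J" "x - \<nu> j \<in> ?H" "\<And>i. i \<in> ?J \<Longrightarrow> x - \<nu> i \<in> ?H \<Longrightarrow> i = j"
        using reps[of x] by metis
      show ?thesis
      proof (rule ex1I[of _ "\<nu> j"])
        show "\<nu> j \<in> \<nu> ` ?J \<and> x - \<nu> j \<in> ?H" using j by blast
        show "a = \<nu> j" if "a \<in> \<nu> ` ?J \<and> x - a \<in> ?H" for a using that j(3) by blast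
      qed
    qed
    show "?ch h = 1" if h: "h \<in> ?H" for h
    proof -
      obtain z where "h = int lam *s z" using h by blast
      then show ?thesis
        using cis_rvec_inner[of z k] assms(1) by (simp add: rvec_mult mult.assoc)
    qed
    show "?ch (axis i 1) \<noteq> 1"
      using i by (simp add: rvec_axis inner_commute)
  qed (fact H | simp add: rvec_add inner_add_left cis_mult distrib_left add_divide_distrib)+
  then show ?thesis
    unfolding sum.reindex[OF inj] comp_def .
qed

text \<open>Reducing coordinates modulo \<open>lam\<close> does not change the class, so
  \<open>\<Gamma>\<close> is covered by the representatives of the finite box
  \<open>?F\<close>.\<close>

lemma finite_dual_reps:
  fixes \<Gamma> :: "(real ^ 'n::finite) set"
  assumes "lam > 0" "dual_reps lam \<Gamma>"
  shows "finite \<Gamma>"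
proof -
  let ?r = "\<lambda>k. (2 * pi / real lam) *\<^sub>R rvec k"
  let ?F = "vec_lambda ` (PiE UNIV (\<lambda>_. {0..<int lam})) :: (int ^ 'n) set"
  define \<rho> where "\<rho> k = (THE \<gamma>. \<gamma> \<in> \<Gamma> \<and> (\<exists>z. ?r k - \<gamma> = (2 * pi) *\<^sub>R rvec z))" for k
  have uniq: "\<exists>!\<gamma>. \<gamma> \<in> \<Gamma> \<and> (\<exists>z. ?r k - \<gamma> = (2 * pi) *\<^sub>R rvec z)" for k
    using assms(2) by (simp add: dual_reps_def)
  have "\<gamma> \<in> \<rho> ` ?F" if \<gamma>: "\<gamma> \<in> \<Gamma>" for \<gamma>
  proof -
    obtain k where k: "\<gamma> = ?r k"
      using \<gamma> assms(2) unfolding dual_reps_def by blast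
    define k' :: "int ^ 'n" where "k' = (\<chi> i. k $ i mod int lam)"
    define z :: "int ^ 'n" where "z = (\<chi> i. - (k $ i div int lam))"
    have "k' - k = int lam *s z"
      unfolding k'_def z_def by (simp add: vec_eq_iff minus_mult_div_eq_mod[symmetric])
    then have "?r k' - \<gamma> = (2 * pi / real lam) *\<^sub>R rvec (int lam *s z)"
      unfolding k by (simp flip: scaleR_diff_right rvec_diff)
    then have "?r k' - \<gamma> = (2 * pi) *\<^sub>R rvec z"
      using assms(1) by (simp add: rvec_mult)
    then have "\<rho> k' = \<gamma>"
      unfolding \<rho>_def using \<gamma> uniq[of k'] by (intro the1_equality) blast+
    moreover have "k' \<in> ?F"
      unfolding k'_def using assms(1) by (intro imageI) auto
    ultimately show ?thesis by blast
  qed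
  moreover have "finite ?F" by (intro finite_imageI finite_PiE) auto
  ultimately show ?thesis by (meson finite_imageI finite_subset subsetI)
qed

lemma dual_character_sum:
  assumes "lam > 0" "dual_reps lam \<Gamma>" "\<nexists>z. k = int lam *s z"
  shows "(\<Sum>\<gamma>\<in>\<Gamma>. cis (rvec k \<bullet> \<gamma>)) = 0"
proof -
  let ?C = "range (\<lambda>k. (2 * pi / real lam) *\<^sub>R rvec k)"
  let ?H = "range (\<lambda>z. (2 * pi) *\<^sub>R rvec z)"
  obtain i where i: "cis (rvec k \<bullet> ((2 * pi / real lam) *\<^sub>R axis i 1)) \<noteq> 1"
    using exists_axis_character[OF assms(1,3)] by blast
  show ?thesis
  proof (rule character_sum_eq_0[where C = ?C and H = ?H
        and e = "(2 * pi / real lam) *\<^sub>R axis i 1"])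
    show "x + (2 * pi / real lam) *\<^sub>R axis i 1 \<in> ?C" if "x \<in> ?C" for x
      using that by (auto simp flip: rvec_axis scaleR_add_right rvec_add)
    show "\<exists>!a. a \<in> \<Gamma> \<and> x - a \<in> ?H" if x: "x \<in> ?C" for x
    proof -
      obtain j where "x = (2 * pi / real lam) *\<^sub>R rvec j" using x by blast
      then show ?thesis using assms(2) by (simp add: dual_reps_def image_iff)
    qed
    show "0 \<in> ?H" by (rule range_eqI[of _ _ 0]) (simp add: rvec_0)
    show "x - y \<in> ?H" if "x \<in> ?H" "y \<in> ?H" for x y
      using that by (auto simp flip: scaleR_diff_right rvec_diff)
    show "\<Gamma> \<subseteq> ?C" using assms(2) by (simp add: dual_reps_def)
    show "cis (rvec k \<bullet> h) = 1" if "h \<in> ?H" for h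
      using that cis_rvec_inner by auto
  qed (use finite_dual_reps[OF assms(1,2)] i in \<open>simp_all add: inner_add_right cis_mult\<close>)
qed

section \<open>Vanishing moments of the masks\<close>

lemma lattice_reps_distinct:
  assumes "lattice_reps lam (\<nu> :: nat \<Rightarrow> int ^ 'n::finite)"
    "l \<in> {1..lam ^ CARD('n)}" "\<mu> \<in> {1..lam ^ CARD('n)}" "l \<noteq> \<mu>"
  shows "\<nexists>z. \<nu> l - \<nu> \<mu> = int lam *s z"
proof
  assume "\<exists>z. \<nu> l - \<nu> \<mu> = int lam *s z"
  moreover have "\<exists>z. \<nu> l - \<nu> l = int lam *s z"
    by (rule exI[of _ 0]) (simp add: vec_eq_iff)
  ultimately show False
    using assms unfolding lattice_reps_def by blast
qed

text \<open>If \<open>lam\<close> divided \<open>k\<close>, both \<open>0\<close> and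
  \<open>\<gamma>\<close> would represent the class of zero.\<close>

lemma dual_reps_nonzero:
  assumes "dual_reps lam \<Gamma>" "\<gamma> \<in> \<Gamma>" "\<gamma> \<noteq> 0" "lam > 0"
  obtains k where "\<gamma> = (2 * pi / real lam) *\<^sub>R rvec k" "\<nexists>z. k = int lam *s z"
proof -
  obtain k where k: "\<gamma> = (2 * pi / real lam) *\<^sub>R rvec k"
    using assms unfolding dual_reps_def by blast
  have "\<nexists>z. k = int lam *s z"
  proof
    assume "\<exists>z. k = int lam *s z"
    then obtain z where "k = int lam *s z" ..
    then have "(2 * pi / real lam) *\<^sub>R rvec k - 0 = (2 * pi) *\<^sub>R rvec z"
      using assms(4) by (simp add: rvec_mult)
    moreover have "(2 * pi / real lam) *\<^sub>R rvec k - \<gamma> = (2 * pi) *\<^sub>R rvec 0"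
      by (simp add: k rvec_0)
    moreover have "0 \<in> \<Gamma>" using assms by (simp add: dual_reps_def)
    ultimately show False
      using assms unfolding dual_reps_def by blast
  qed
  with k show thesis by (rule that)
qed

lemma polyphase:
  fixes \<nu> :: "nat \<Rightarrow> int ^ 'n::finite"
  assumes "lam > 0" "lattice_reps lam \<nu>" "dual_reps lam \<Gamma>"
    and \<mu>: "\<mu> \<in> {1..lam ^ CARD('n)}"
    and P: "\<And>l \<gamma> \<omega>. \<gamma> \<in> \<Gamma> \<Longrightarrow> P l (\<omega> + \<gamma>) = P l \<omega>"
    and \<tau>: "\<And>\<omega>. \<tau> \<omega> = (\<Sum>l = 1..lam ^ CARD('n). s * P l \<omega> * cis (rvec (\<nu> l) \<bullet> \<omega>))"
  shows "(\<Sum>\<gamma>\<in>\<Gamma>. \<tau> (\<omega> + \<gamma>) * cis (- rvec (\<nu> \<mu>) \<bullet> (\<omega> + \<gamma>))) = s * of_nat (card \<Gamma>) * P \<mu> \<omega>"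
proof -
  let ?J = "{1..lam ^ CARD('n)}"
  have "(\<Sum>\<gamma>\<in>\<Gamma>. \<tau> (\<omega> + \<gamma>) * cis (- rvec (\<nu> \<mu>) \<bullet> (\<omega> + \<gamma>))) =
      (\<Sum>\<gamma>\<in>\<Gamma>. \<Sum>l\<in>?J. s * P l \<omega> * cis (rvec (\<nu> l - \<nu> \<mu>) \<bullet> \<omega>) * cis (rvec (\<nu> l - \<nu> \<mu>) \<bullet> \<gamma>))"
    by (simp add: \<tau> P sum_distrib_right rvec_diff inner_add_right inner_diff_left cis_mult
        mult.assoc) (simp add: algebra_simps)
  also have "\<dots> = (\<Sum>l\<in>?J. s * P l \<omega> * cis (rvec (\<nu> l - \<nu> \<mu>) \<bullet> \<omega>) *
      (\<Sum>\<gamma>\<in>\<Gamma>. cis (rvec (\<nu> l - \<nu> \<mu>) \<bullet> \<gamma>)))"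
    by (subst sum.swap) (simp add: sum_distrib_left)
  \<comment> \<open>For \<open>l\<close> other than \<open>\<mu>\<close> the difference of
    representatives is not in the sublattice and the inner sum vanishes; for
    \<open>l = \<mu>\<close> every summand is \<open>1\<close>.\<close>
  also have "\<dots> = (\<Sum>l\<in>?J. if l = \<mu> then s * P \<mu> \<omega> * of_nat (card \<Gamma>) else 0)"
    using dual_character_sum[OF assms(1,3) lattice_reps_distinct[OF assms(2) _ \<mu>]]
    by (intro sum.cong) (auto simp: rvec_0)
  also have "\<dots> = s * of_nat (card \<Gamma>) * P \<mu> \<omega>"
    using \<mu> by simp
  finally show ?thesis .
qed

section \<open>Univariate factors and the two kinds of wavelet masks\<close>

lemma real_trig_poly_periodic:
  assumes "real_trig_poly B"
  shows "B (t + 2 * pi * of_int j) = B t"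
proof -
  have "cis (- (of_int k * (t + 2 * pi * of_int j))) = cis (- (of_int k * t))" for k :: int
  proof -
    have "cis (- (of_int k * t) + 2 * pi * of_int (- (k * j))) = cis (- (of_int k * t))"
      by (simp only: cis_mult[symmetric] cis_2pi_int mult_1_right)
    then show ?thesis by (simp add: algebra_simps)
  qed
  with assms show ?thesis by (auto simp: real_trig_poly_def)
qed

lemma exp_poly_real_trig_poly:
  assumes "real_trig_poly B"
  shows "exp_poly (\<lambda>\<omega>. B (v \<bullet> \<omega>))"
proof -
  obtain K and c :: "int \<Rightarrow> real"
    where "\<And>t. B t = (\<Sum>k\<in>K. of_real (c k) * cis (- (of_int k * t)))"
    using assms by (auto simp: real_trig_poly_def)
  then have "(\<lambda>\<omega>. B (v \<bullet> \<omega>)) =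
      (\<lambda>\<omega>. \<Sum>k\<in>K. of_real (c k) * cis ((- of_int k *\<^sub>R v) \<bullet> \<omega>))"
    by simp
  then show ?thesis by (simp only: exp_poly_sum exp_poly_term)
qed

lemma vanishing_moments_directional:
  assumes "\<xi> \<noteq> 0" "lam > 0" "exp_poly \<tau>" "\<tau> 0 \<noteq> 0" "c \<noteq> 0"
  shows "vanishing_moments
    (\<lambda>\<omega>. c * (1 - cis (- (real lam * (rvec \<xi> \<bullet> \<omega>)))) ^ k * \<tau> \<omega>) = enat k"
proof -
  define w where "w = - real lam *\<^sub>R rvec \<xi>"
  define u where "u = (\<lambda>\<omega>. 1 - cis (w \<bullet> \<omega>))"
  define g where "g = (\<lambda>\<omega>. c * \<tau> \<omega>)"
  \<comment> \<open>A coordinate in which the direction is nonzero is one in which \<open>u\<close>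
    has nonzero derivative at \<open>0\<close>, making that zero simple.\<close>
  obtain i where i: "\<xi> $ i \<noteq> 0" using assms(1) by (auto simp: vec_eq_iff)
  have u: "exp_poly u" "u 0 = 0" and g: "exp_poly g" "g 0 \<noteq> 0"
    using assms unfolding u_def g_def by (auto intro: exp_poly_intros)
  have "u = (\<lambda>\<omega>. 1 + (- 1) * cis (w \<bullet> \<omega>))"
    by (simp add: u_def)
  then have "partial_deriv i u 0 = - \<i> * of_real (w $ i)"
    by (simp only: partial_deriv_add exp_poly_const exp_poly_term partial_deriv_const
        partial_deriv_term) simp
  then have "partial_deriv i u 0 \<noteq> 0"
    using i assms(2) by (simp add: w_def rvec_def)
  then have "\<not> vanishes (Suc k) (\<lambda>\<omega>. u \<omega> ^ k * g \<omega>) 0"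
    by (intro not_vanishes_power_mult u g)
  moreover have "vanishes k (\<lambda>\<omega>. g \<omega> * u \<omega> ^ k) 0"
    by (intro vanishes_mult_left vanishes_power exp_poly_power u g)
  ultimately have "root_order (\<lambda>\<omega>. u \<omega> ^ k * g \<omega>) 0 = enat k"
    by (intro root_order_eqI exp_poly_mult exp_poly_power u g) (simp_all add: mult.commute)
  moreover have "(\<lambda>\<omega>. u \<omega> ^ k * g \<omega>) =
      (\<lambda>\<omega>. c * (1 - cis (- (real lam * (rvec \<xi> \<bullet> \<omega>)))) ^ k * \<tau> \<omega>)"
    by (simp add: u_def g_def w_def mult_ac)
  ultimately show ?thesis by (simp add: vanishing_moments_def)
qed

text \<open>The hypothesis \<open>zero\<close> stands beside \<open>acc\<close> because for
  \<open>d = 0\<close> the latter carries no information, while the constant \<open>C\<close> is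
  found from the values of \<open>\<tau>\<close> on \<open>\<Gamma>\<close>.\<close>

lemma vanishing_moments_complementary:
  fixes \<Gamma> :: "(real ^ 'n::finite) set"
  assumes "exp_poly \<tau>" "exp_poly P" "finite \<Gamma>" "0 \<in> \<Gamma>" "s * r = 1" "P 0 = 1"
    and zero: "\<And>\<gamma>. \<gamma> \<in> \<Gamma> - {0} \<Longrightarrow> \<tau> \<gamma> = 0" and "\<tau> 0 = r"
    and polyphase: "\<And>\<omega>. (\<Sum>\<gamma>\<in>\<Gamma>. \<tau> (\<omega> + \<gamma>) * cis (- v \<bullet> (\<omega> + \<gamma>))) = C * P \<omega>"
    and acc: "\<And>\<gamma>. \<gamma> \<in> \<Gamma> - {0} \<Longrightarrow> vanishes d \<tau> \<gamma>"
    and flat: "vanishes d (\<lambda>\<omega>. \<tau> \<omega> - r) 0"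
  shows "vanishes d (\<lambda>\<omega>. cis (v \<bullet> \<omega>) - s * \<tau> \<omega> * cnj (P \<omega>)) 0"
proof -
  text \<open>Evaluation at \<open>0\<close> determines \<open>C\<close>, which spares counting \<open>\<Gamma>\<close>.\<close>
  have "C = r"
  proof -
    have "C * P 0 = (\<Sum>\<gamma>\<in>\<Gamma>. if \<gamma> = 0 then r else 0)"
      unfolding polyphase[symmetric] using zero \<open>\<tau> 0 = r\<close> by (intro sum.cong) auto
    then show ?thesis using assms by simp
  qed
  \<comment> \<open>The error in approximating \<open>P\<close> by a pure character. The polyphase
    identity, solved for \<open>P\<close>, writes it through the translates of \<open>\<tau>\<close>
    at nonzero \<open>\<gamma>\<close> and through \<open>\<tau> - r\<close>.\<close>
  define D where "D = (\<lambda>\<omega>. P \<omega> - cis (- v \<bullet> \<omega>))"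
  have D: "exp_poly D" unfolding D_def by (intro exp_poly_intros assms)
  have "vanishes d (\<lambda>\<omega>. s * ((\<Sum>\<gamma>\<in>\<Gamma> - {0}. cis (- v \<bullet> (\<omega> + \<gamma>)) * \<tau> (\<omega> + \<gamma>)) +
      cis (- v \<bullet> \<omega>) * (\<tau> \<omega> - r))) 0"
    using acc
    by (intro vanishes_mult_left vanishes_add vanishes_sum vanishes_shift flat exp_poly_intros
        exp_poly_shift[of "\<lambda>\<omega>. cis (- v \<bullet> \<omega>)"] assms(1)) simp_all
  also have "(\<lambda>\<omega>. s * ((\<Sum>\<gamma>\<in>\<Gamma> - {0}. cis (- v \<bullet> (\<omega> + \<gamma>)) * \<tau> (\<omega> + \<gamma>)) +
      cis (- v \<bullet> \<omega>) * (\<tau> \<omega> - r))) = D"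
  proof
    fix \<omega>
    have "(\<Sum>\<gamma>\<in>\<Gamma> - {0}. cis (- v \<bullet> (\<omega> + \<gamma>)) * \<tau> (\<omega> + \<gamma>)) =
        r * P \<omega> - \<tau> \<omega> * cis (- v \<bullet> \<omega>)"
      using polyphase[of \<omega>] \<open>C = r\<close> unfolding sum.remove[OF assms(3,4)]
      by (simp add: mult.commute algebra_simps)
    then have "s * ((\<Sum>\<gamma>\<in>\<Gamma> - {0}. cis (- v \<bullet> (\<omega> + \<gamma>)) * \<tau> (\<omega> + \<gamma>)) +
        cis (- v \<bullet> \<omega>) * (\<tau> \<omega> - r)) = (s * r) * D \<omega>"
      unfolding D_def by (simp only: algebra_simps)
    then show "s * ((\<Sum>\<gamma>\<in>\<Gamma> - {0}. cis (- v \<bullet> (\<omega> + \<gamma>)) * \<tau> (\<omega> + \<gamma>)) +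
        cis (- v \<bullet> \<omega>) * (\<tau> \<omega> - r)) = D \<omega>"
      using assms by simp
  qed
  \<comment> \<open>The mask splits into a multiple of \<open>cnj D\<close> and a multiple of
    \<open>\<tau> - r\<close>; the leftover character has coefficient
    \<open>s * r = 1\<close>.\<close>
  finally have "vanishes d (\<lambda>\<omega>. - s * \<tau> \<omega> * cnj (D \<omega>) + - s * cis (v \<bullet> \<omega>) * (\<tau> \<omega> - r)) 0"
    by (intro vanishes_mult_left vanishes_add vanishes_cnj flat exp_poly_intros D assms)
  moreover have "- s * \<tau> \<omega> * cnj (D \<omega>) + - s * cis (v \<bullet> \<omega>) * (\<tau> \<omega> - r) =
      cis (v \<bullet> \<omega>) - s * \<tau> \<omega> * cnj (P \<omega>)" for \<omega>
  proof -
    have "- s * \<tau> \<omega> * cnj (D \<omega>) + - s * cis (v \<bullet> \<omega>) * (\<tau> \<omega> - r) =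
        (s * r) * cis (v \<bullet> \<omega>) - s * \<tau> \<omega> * cnj (P \<omega>)"
      by (simp add: D_def cis_cnj algebra_simps)
    then show ?thesis using assms by simp
  qed
  ultimately show ?thesis by simp
qed

theorem corollary3p1:
  fixes lam N :: nat
    and \<xi> \<nu> :: "nat \<Rightarrow> int ^ 'n::finite"
    and m :: "nat \<Rightarrow> nat"
    and \<Gamma> :: "(real ^ 'n) set"
    and \<tau> :: "real ^ 'n \<Rightarrow> complex"
    and qD qC :: "nat \<Rightarrow> real ^ 'n \<Rightarrow> complex"
    and a b :: enat
  assumes "CARD('n) \<ge> 2"
    and "N \<ge> 1"
    and "lam \<ge> 2"
    and "N \<le> lam ^ CARD('n)"
    and "\<forall>l\<in>{1..N}. \<xi> l \<noteq> 0"
    and "\<forall>l\<in>{1..N}. m l > 0"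
    and "lattice_reps lam \<nu>"
    and "dual_reps lam \<Gamma>"
    and "is_TWFPD lam N \<xi> m \<nu> \<tau> qD qC"
    and "a = accuracy_number \<Gamma> \<tau>"
    and "b = flatness_number lam \<tau>"
  shows "(\<forall>l\<in>{1..N}. vanishing_moments (qD l) = enat (m l)) \<and>
    (min a b \<ge> 1 \<and>
     (\<forall>\<mu>\<in>{1..lam ^ CARD('n)}. vanishing_moments (qC \<mu>) \<ge> min a b))"
proof -
  define M where "M = lam ^ CARD('n)"
  define r :: complex where "r = of_real (real lam powr (real CARD('n) / 2))"
  obtain B p s where s_def: "s = of_real (real lam powr (- (real CARD('n) / 2)))"
    and B: "\<And>l. l \<in> {1..N} \<Longrightarrow> real_trig_poly (B l)" "\<And>l. l \<in> {1..N} \<Longrightarrow> B l 0 = 1"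
    and p: "\<And>l \<omega>. l \<in> {1..N} \<Longrightarrow> p l \<omega> = B l (rvec (\<xi> l) \<bullet> \<omega>)"
    and \<tau>: "\<And>\<omega>. \<tau> \<omega> = (\<Sum>l = 1..N. s * p l (real lam *\<^sub>R \<omega>) * cis (rvec (\<nu> l) \<bullet> \<omega>)) +
           (\<Sum>l = N + 1..M. s * cis (rvec (\<nu> l) \<bullet> \<omega>))"
    and qD: "\<And>l \<omega>. l \<in> {1..N} \<Longrightarrow> qD l \<omega> =
           s * (1 / 2 ^ m l) * (1 - cis (- (real lam * (rvec (\<xi> l) \<bullet> \<omega>)))) ^ m l * \<tau> \<omega>"
    and qC1: "\<And>\<mu> \<omega>. \<mu> \<in> {1..N} \<Longrightarrow> qC \<mu> \<omega> =
           cis (rvec (\<nu> \<mu>) \<bullet> \<omega>) - s * \<tau> \<omega> * cnj (p \<mu> (real lam *\<^sub>R \<omega>))"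
    and qC2: "\<And>\<mu> \<omega>. \<mu> \<in> {N + 1..M} \<Longrightarrow> qC \<mu> \<omega> = cis (rvec (\<nu> \<mu>) \<bullet> \<omega>) - s * \<tau> \<omega>"
    using assms(9) unfolding is_TWFPD_def M_def
    apply (elim exE)
    subgoal premises W for B p s
      by (rule W(1)[of s B p]; use W(2) in blast)
    done
  \<comment> \<open>The default \<open>1\<close> for indices beyond \<open>N\<close> merges the two
    sums in \<open>\<tau>\<close> and the two cases of \<open>qC\<close>.\<close>
  define P where
    "P l \<omega> = (if l \<in> {1..N} then B l (real lam *\<^sub>R rvec (\<xi> l) \<bullet> \<omega>) else 1)" for l \<omega>
  have lam: "lam > 0" and "r \<noteq> 0" "s \<noteq> 0"
    using assms(3) by (auto simp: r_def s_def)
  have sr: "s * r = 1" and r2: "r * r = of_nat M"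
  proof -
    show "s * r = 1"
      using lam unfolding s_def r_def by (simp flip: of_real_mult powr_add)
    have "real lam powr (real CARD('n) / 2) * real lam powr (real CARD('n) / 2) = real M"
      using lam by (simp add: M_def powr_realpow flip: powr_add)
    then show "r * r = of_nat M"
      unfolding r_def by (metis of_real_mult of_real_of_nat_eq)
  qed
  have P_exp: "exp_poly (P l)" for l
  proof (cases "l \<in> {1..N}")
    case True
    then show ?thesis
      using exp_poly_real_trig_poly[OF B(1)[OF True], of "real lam *\<^sub>R rvec (\<xi> l)"]
      unfolding P_def by simp
  next
    case False
    then show ?thesis
      using exp_poly_const[of 1] unfolding P_def by (simp only: if_False)
  qed
  have P0: "P l 0 = 1" for l
    by (simp add: P_def B(2))
  \<comment> \<open>The translation changes the argument of \<open>B l\<close> by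
    \<open>2 * pi\<close> times an integer, the inner product of \<open>\<xi> l\<close> and
    \<open>k\<close>.\<close>
  have P_per: "P l (\<omega> + (2 * pi / real lam) *\<^sub>R rvec k) = P l \<omega>" for l \<omega> k
  proof -
    have "real lam *\<^sub>R rvec (\<xi> l) \<bullet> (\<omega> + (2 * pi / real lam) *\<^sub>R rvec k) =
        real lam *\<^sub>R rvec (\<xi> l) \<bullet> \<omega> + 2 * pi * of_int (\<Sum>i\<in>UNIV. \<xi> l $ i * k $ i)"
      using lam by (simp add: inner_add_right rvec_inner algebra_simps del: of_int_sum)
    then show ?thesis
      using real_trig_poly_periodic[OF B(1)] unfolding P_def by presburger
  qed
  have \<tau>_P: "\<tau> \<omega> = (\<Sum>l = 1..M. s * P l \<omega> * cis (rvec (\<nu> l) \<bullet> \<omega>))" for \<omega>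
  proof -
    have "(\<Sum>l = 1..M. s * P l \<omega> * cis (rvec (\<nu> l) \<bullet> \<omega>)) =
        (\<Sum>l = 1..N. s * P l \<omega> * cis (rvec (\<nu> l) \<bullet> \<omega>)) +
        (\<Sum>l = N + 1..M. s * P l \<omega> * cis (rvec (\<nu> l) \<bullet> \<omega>))"
      using assms(4) sum.ub_add_nat[of 1 N _ "M - N"] by (simp add: M_def)
    then show ?thesis
      by (simp add: \<tau> P_def p)
  qed
  have \<tau>_exp: "exp_poly \<tau>"
    by (subst fun_eq_iff[THEN iffD2, OF allI, OF \<tau>_P]) (intro exp_poly_intros P_exp)
  have "\<tau> 0 = s * (r * r)"
    unfolding \<tau>_P by (simp add: P0 r2)
  then have \<tau>0: "\<tau> 0 = r"
    using sr by (simp add: mult.assoc[symmetric])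
  \<comment> \<open>By periodicity every \<open>P l\<close> is \<open>1\<close> at
    \<open>\<gamma>\<close>, so \<open>\<tau> \<gamma>\<close> is a multiple of a lattice character
    sum.\<close>
  have zero: "\<tau> \<gamma> = 0" if \<gamma>: "\<gamma> \<in> \<Gamma> - {0}" for \<gamma>
  proof -
    obtain k where k: "\<gamma> = (2 * pi / real lam) *\<^sub>R rvec k" "\<nexists>z. k = int lam *s z"
      using dual_reps_nonzero[OF assms(8)] \<gamma> lam by blast
    have "P l \<gamma> = 1" for l
      using P_per[of l 0 k] by (simp add: P0 k(1))
    then have "\<tau> \<gamma> = s * (\<Sum>l = 1..M. cis (rvec (\<nu> l) \<bullet> \<gamma>))"
      by (simp add: \<tau>_P sum_distrib_left)
    then show ?thesis
      using lattice_character_sum[OF lam assms(7) k(2)] by (simp add: k(1) M_def)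
  qed
  have flat_exp: "exp_poly (\<lambda>\<omega>. \<tau> \<omega> - r)"
    by (intro exp_poly_intros \<tau>_exp)
  have le_a: "enat d \<le> a \<longleftrightarrow> (\<forall>\<gamma>\<in>\<Gamma> - {0}. vanishes d \<tau> \<gamma>)" for d
    by (simp add: assms(10) accuracy_number_def le_INF_iff enat_le_root_order_iff \<tau>_exp)
  have le_b: "enat d \<le> b \<longleftrightarrow> vanishes d (\<lambda>\<omega>. \<tau> \<omega> - r) 0" for d
    unfolding assms(11) flatness_number_def r_def[symmetric]
    by (rule enat_le_root_order_iff[OF flat_exp])

  have "vanishing_moments (qD l) = enat (m l)" if l: "l \<in> {1..N}" for l
    unfolding fun_eq_iff[THEN iffD2, OF allI, OF qD[OF l]]
    using assms(5) l \<tau>_exp \<tau>0 \<open>r \<noteq> 0\<close> \<open>s \<noteq> 0\<close> lam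
    by (intro vanishing_moments_directional) auto
  \<comment> \<open>Order at least \<open>1\<close> only concerns values: \<open>zero\<close>
    handles accuracy and \<open>\<tau> 0 = r\<close> handles flatness.\<close>
  moreover have "min a b \<ge> 1"
    using le_a[of 1] le_b[of 1] zero \<tau>0 by (simp add: one_enat_def)
  moreover have "vanishing_moments (qC \<mu>) \<ge> min a b" if \<mu>: "\<mu> \<in> {1..M}" for \<mu>
  proof -
    have qC: "qC \<mu> = (\<lambda>\<omega>. cis (rvec (\<nu> \<mu>) \<bullet> \<omega>) - s * \<tau> \<omega> * cnj (P \<mu> \<omega>))"
      using \<mu> qC1[of \<mu>] qC2[of \<mu>] by (cases "\<mu> \<le> N") (auto simp: P_def p)
    have qC_exp: "exp_poly (qC \<mu>)"
      unfolding qC by (intro exp_poly_intros \<tau>_exp P_exp)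
    have polyphase_\<mu>: "(\<Sum>\<gamma>\<in>\<Gamma>. \<tau> (\<omega> + \<gamma>) * cis (- rvec (\<nu> \<mu>) \<bullet> (\<omega> + \<gamma>))) =
        s * of_nat (card \<Gamma>) * P \<mu> \<omega>" for \<omega>
      using assms(8) \<mu> \<tau>_P
      by (intro polyphase[OF lam assms(7,8)]) (auto simp: dual_reps_def P_per M_def)
    have "0 \<in> \<Gamma>"
      using assms(8) by (simp add: dual_reps_def)
    have "enat d \<le> vanishing_moments (qC \<mu>)" if "enat d \<le> min a b" for d
    proof -
      have "vanishes d (qC \<mu>) 0"
        unfolding qC using that le_a le_b
        by (intro vanishing_moments_complementary[OF \<tau>_exp P_exp finite_dual_reps[OF lam assms(8)]
              \<open>0 \<in> \<Gamma>\<close> sr P0 zero \<tau>0 polyphase_\<mu>]) auto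
      then show ?thesis
        by (simp add: vanishing_moments_def enat_le_root_order_iff qC_exp)
    qed
    then show ?thesis
      by (rule enat_le_by_finite)
  qed
  ultimately show ?thesis by (simp add: M_def)
qed

end
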